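(* Let $\Sigma$ be a finite alphabet and let $L \subseteq \Sigma^*$ be a fixed regular language. Then the following decision problem is solvable in polynomial time: given as input a commutative (deterministic and complete) semi-automaton $\mathcal A = (\Sigma, Q, \delta)$ with $n$ states, decide whether there exists a synchronizing word $w$ for $\mathcal A$ with $w \in L$.
   Context: A deterministic and complete semi-automaton is a triple $\mathcal A = (\Sigma, Q, \delta)$ with $\Sigma$ a finite alphabet, $Q$ a finite set of states and $\delta\colon Q\times\Sigma\to Q$ a total transition function, extended to $\delta\colon Q \times \Sigma^* \to Q$ in the usual way; for $S\subseteq Q$, $\delta(S,w)=\{\delta(q,w) \mid q\in S\}$. $\mathcal A$ is commutative if $\delta(q,ab)=\delta(q,ba)$ for all $q\in Q$ and $a,b\in\Sigma$. A word $w\in\Sigma^*$ is a synchronizing word for $\mathcal A$ if $|\delta(Q,w)|=1$. The language $L$ (and hence the alphabet $\Sigma$) is fixed and not part of the input; the input is only $\mathcal A$. *)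

theory Defs
  imports Main "HOL-Computational_Algebra.Polynomial"
begin

section \<open>Semi-automata\<close>

record ('q, 'a) semi_automaton =
  alphabet :: "'a set"
  states :: "'q set"
  trans :: "'q \<Rightarrow> 'a \<Rightarrow> 'q"

text \<open>Deterministic and complete; the values of \<open>trans\<close> outside
  \<open>states \<times> alphabet\<close> are irrelevant.\<close>

definition is_semi_automaton :: "('q, 'a) semi_automaton \<Rightarrow> bool" where
  "is_semi_automaton A \<longleftrightarrow>
     finite (alphabet A) \<and> finite (states A) \<and>
     (\<forall>q\<in>states A. \<forall>a\<in>alphabet A. trans A q a \<in> states A)"

definition trans_word :: "('q, 'a) semi_automaton \<Rightarrow> 'q \<Rightarrow> 'a list \<Rightarrow> 'q" where
  "trans_word A q w = foldl (trans A) q w"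

definition trans_set :: "('q, 'a) semi_automaton \<Rightarrow> 'q set \<Rightarrow> 'a list \<Rightarrow> 'q set" where
  "trans_set A S w = (\<lambda>q. trans_word A q w) ` S"

definition commutative :: "('q, 'a) semi_automaton \<Rightarrow> bool" where
  "commutative A \<longleftrightarrow>
     (\<forall>q\<in>states A. \<forall>a\<in>alphabet A. \<forall>b\<in>alphabet A.
        trans_word A q [a, b] = trans_word A q [b, a])"

definition synchronizing :: "('q, 'a) semi_automaton \<Rightarrow> 'a list \<Rightarrow> bool" where
  "synchronizing A w \<longleftrightarrow>
     w \<in> lists (alphabet A) \<and> card (trans_set A (states A) w) = 1"

text \<open>Regular languages are those accepted by complete deterministic finite automata.
  Since state sets are finite, it is no restriction to take natural numbers as states.\<close>

definition regular :: "'a set \<Rightarrow> 'a list set \<Rightarrow> bool" where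
  "regular \<Sigma> L \<longleftrightarrow>
     (\<exists>(A :: (nat, 'a) semi_automaton) q0 F.
        is_semi_automaton A \<and> alphabet A = \<Sigma> \<and> q0 \<in> states A \<and> F \<subseteq> states A \<and>
        L = {w \<in> lists \<Sigma>. trans_word A q0 w \<in> F})"


section \<open>Polynomial time\<close>

text \<open>The machine model is the random access machine of Cook and Reckhow with unit cost.
  There are registers \<open>X 0, X 1, \<dots>\<close> holding natural numbers, all initially 0, and a
  read-only input word over the alphabet of bits. As arithmetic is limited to addition and
  truncated subtraction, a number occurring after \<open>t\<close> steps has \<open>O(t)\<close> bits (the constants
  of the program being fixed), so the model is polynomially equivalent to Turing machines.

  \<^item> \<open>Const i c\<close>: \<open>X i := c\<close>
  \<^item> \<open>Add i j k\<close>, \<open>Sub i j k\<close>: \<open>X i := X j + X k\<close>, \<open>X i := X j - X k\<close>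
  \<^item> \<open>Load i j\<close>, \<open>Store i j\<close>: \<open>X i := X (X j)\<close>, \<open>X (X i) := X j\<close>
  \<^item> \<open>Read i j\<close>: \<open>X i\<close> becomes the input bit at position \<open>X j\<close>, or the end marker 2 if the
    input has no such position
  \<^item> \<open>Jump i l\<close>: continue with instruction number \<open>l\<close> if \<open>X i > 0\<close>

  The machine halts when the program counter leaves the program.\<close>

datatype instr =
    Const nat nat
  | Add nat nat nat
  | Sub nat nat nat
  | Load nat nat
  | Store nat nat
  | Read nat nat
  | Jump nat nat

type_synonym config = "nat \<times> (nat \<Rightarrow> nat)"

definition input_at :: "bool list \<Rightarrow> nat \<Rightarrow> nat" where
  "input_at x i = (if i < length x then (if x ! i then 1 else 0) else 2)"

fun exec_instr :: "bool list \<Rightarrow> instr \<Rightarrow> config \<Rightarrow> config" where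
  "exec_instr x (Const i c) (pc, X) = (Suc pc, X(i := c))"
| "exec_instr x (Add i j k) (pc, X) = (Suc pc, X(i := X j + X k))"
| "exec_instr x (Sub i j k) (pc, X) = (Suc pc, X(i := X j - X k))"
| "exec_instr x (Load i j) (pc, X) = (Suc pc, X(i := X (X j)))"
| "exec_instr x (Store i j) (pc, X) = (Suc pc, X(X i := X j))"
| "exec_instr x (Read i j) (pc, X) = (Suc pc, X(i := input_at x (X j)))"
| "exec_instr x (Jump i l) (pc, X) = (if X i > 0 then l else Suc pc, X)"

definition halted :: "instr list \<Rightarrow> config \<Rightarrow> bool" where
  "halted P c \<longleftrightarrow> fst c \<ge> length P"

definition step :: "instr list \<Rightarrow> bool list \<Rightarrow> config \<Rightarrow> config" where
  "step P x c = (if halted P c then c else exec_instr x (P ! fst c) c)"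

definition run :: "instr list \<Rightarrow> bool list \<Rightarrow> nat \<Rightarrow> config" where
  "run P x t = (step P x ^^ t) (0, \<lambda>_. 0)"

text \<open>The answer is given in register 0. Halting configurations are fixed by \<open>step\<close>, so it
  suffices to look at the configuration reached when the time bound is exhausted.\<close>

definition decides_in_time :: "instr list \<Rightarrow> bool list set \<Rightarrow> (nat \<Rightarrow> nat) \<Rightarrow> bool" where
  "decides_in_time P K T \<longleftrightarrow>
     (\<forall>x. let c = run P x (T (length x)) in
        halted P c \<and> snd c 0 = (if x \<in> K then 1 else 0))"

definition polynomial_time :: "bool list set \<Rightarrow> bool" where
  "polynomial_time K \<longleftrightarrow> (\<exists>P (p :: nat poly). decides_in_time P K (poly p))"


section \<open>The decision problem\<close>

text \<open>An input automaton with \<open>n\<close> states has state set \<open>{0..<n}\<close>. It is presented by \<open>n\<close>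
  followed by its transition table, row by row, with columns in the order of the fixed
  enumeration \<open>as\<close> of the alphabet. Numbers are written in unary; as all table entries are
  below \<open>n\<close>, the length of the code lies between \<open>n\<close> and \<open>(n + 1) * (1 + length as * n)\<close>, so
  that polynomial in the length means polynomial in \<open>n\<close>.\<close>

definition unary :: "nat \<Rightarrow> bool list" where
  "unary k = replicate k True @ [False]"

definition encode :: "'a list \<Rightarrow> (nat, 'a) semi_automaton \<Rightarrow> bool list" where
  "encode as A =
     (let n = card (states A) in
        unary n @ concat [unary (trans A q a). q \<leftarrow> [0..<n], a \<leftarrow> as])"

text \<open>The codes of the yes-instances. A machine deciding this set also rejects all bit strings
  that do not encode a commutative semi-automaton.\<close>

definition commutative_constrained_sync :: "'a list \<Rightarrow> 'a list set \<Rightarrow> bool list set" where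
  "commutative_constrained_sync as L =
     {encode as A | A.
        is_semi_automaton A \<and> alphabet A = set as \<and> states A = {0..<card (states A)} \<and>
        commutative A \<and> (\<exists>w\<in>L. synchronizing A w)}"

end

theory Submission
  imports Defs "HOL-Library.Multiset"
begin

text \<open>In a commutative automaton, whether a word is synchronizing depends only on its letter
  counts, is preserved by increasing them, and is not affected by cutting them down to the number
  \<open>n\<close> of states, as the images of the powers of a letter are stable from exponent \<open>n\<close> on. The
  count vectors below those of \<open>L\<close> form a downward closed set, which is a finite union of ideals
  (vectors bounded on some letters and arbitrary on the others). An ideal contains a synchronizing
  vector iff the vector with the maximal bounded entries and the value \<open>n\<close> (or more) elsewhere is
  synchronizing. Hence there are finitely many pairs of words \<open>(u, v)\<close>, depending only on \<open>L\<close>,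
  such that it suffices to test the words \<open>u v\<^sup>N\<close> for some \<open>N \<ge> n\<close>.

  For the machine, the test is written in an expression language in which every loop is executed
  exactly \<open>N = |x| + 1\<close> times on input \<open>x\<close>. Every expression is thus evaluated in polynomial time,
  whatever it computes. The transition table is not stored but looked up by scanning the input.\<close>

section \<open>Expressions compiled to the random access machine\<close>

datatype expr =
    Var nat
  | Cst nat
  | Plus expr expr
  | Minus expr expr
  | Bit expr
  | Bind nat expr expr
  | Rec nat nat expr expr

fun eval :: "bool list \<Rightarrow> (nat \<Rightarrow> nat) \<Rightarrow> expr \<Rightarrow> nat" where
  "eval x \<rho> (Var v) = \<rho> v"
| "eval x \<rho> (Cst c) = c"
| "eval x \<rho> (Plus a b) = eval x \<rho> a + eval x \<rho> b"
| "eval x \<rho> (Minus a b) = eval x \<rho> a - eval x \<rho> b"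
| "eval x \<rho> (Bit a) = input_at x (eval x \<rho> a)"
| "eval x \<rho> (Bind v a b) = eval x (\<rho>(v := eval x \<rho> a)) b"
| "eval x \<rho> (Rec v w a b) =
     rec_nat (eval x \<rho> a) (\<lambda>j z. eval x (\<rho>(v := z, w := j)) b) (Suc (length x))"

text \<open>\<open>compile pc m d e\<close> is code to be placed at address \<open>pc\<close> that leaves the value of \<open>e\<close> in
  register \<open>d\<close> and preserves the registers below \<open>d\<close>, where \<open>m\<close> maps the variables to
  registers below \<open>d\<close>. Registers 0, 1 and 2 hold 0, 1 and the number of iterations of all loops.\<close>

fun compile :: "nat \<Rightarrow> (nat \<Rightarrow> nat) \<Rightarrow> nat \<Rightarrow> expr \<Rightarrow> instr list" where
  "compile pc m d (Var v) = [Add d (m v) 0]"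
| "compile pc m d (Cst c) = [Const d c]"
| "compile pc m d (Plus a b) =
     (let ca = compile pc m d a; cb = compile (pc + length ca) m (Suc d) b
      in ca @ cb @ [Add d d (Suc d)])"
| "compile pc m d (Minus a b) =
     (let ca = compile pc m d a; cb = compile (pc + length ca) m (Suc d) b
      in ca @ cb @ [Sub d d (Suc d)])"
| "compile pc m d (Bit a) = compile pc m d a @ [Read d d]"
| "compile pc m d (Bind v a b) =
     (let ca = compile pc m d a; cb = compile (pc + length ca) (m(v := d)) (Suc d) b
      in ca @ cb @ [Add d (Suc d) 0])"
| "compile pc m d (Rec v w a b) =
     (let ca = compile pc m d a; l = Suc (pc + length ca);
          cb = compile l (m(v := d, w := Suc d)) (Suc (Suc d)) b
      in ca @ [Const (Suc d) 0] @ cb @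
         [Add d (Suc (Suc d)) 0, Add (Suc d) (Suc d) 1, Sub (Suc (Suc d)) 2 (Suc d),
          Jump (Suc (Suc d)) l])"

text \<open>The bound involves only the expression and the input length, not the values computed.
  The factor \<open>[:1, 1:]\<close> is the fixed iteration count, and 4 counts the instructions
  closing a loop body.\<close>

fun cost :: "expr \<Rightarrow> nat poly" where
  "cost (Var v) = 1"
| "cost (Cst c) = 1"
| "cost (Plus a b) = cost a + cost b + 1"
| "cost (Minus a b) = cost a + cost b + 1"
| "cost (Bit a) = cost a + 1"
| "cost (Bind v a b) = cost a + cost b + 1"
| "cost (Rec v w a b) = cost a + 1 + [:1, 1:] * (cost b + 4)"

section \<open>Timed reachability of machine configurations\<close>

definition reach :: "instr list \<Rightarrow> bool list \<Rightarrow> nat \<Rightarrow> config \<Rightarrow> config \<Rightarrow> bool" where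
  "reach P x t c c' \<longleftrightarrow> (\<exists>s\<le>t. (step P x ^^ s) c = c')"

lemma reach_mono: "reach P x s c c' \<Longrightarrow> s \<le> t \<Longrightarrow> reach P x t c c'"
  by (auto simp: reach_def intro: order_trans)

lemma reach_trans:
  assumes "reach P x s c c'" "reach P x t c' c''"
  shows "reach P x (s + t) c c''"
proof -
  obtain s' t' where "s' \<le> s" "(step P x ^^ s') c = c'" "t' \<le> t" "(step P x ^^ t') c' = c''"
    using assms unfolding reach_def by blast
  then have "(step P x ^^ (t' + s')) c = c''" "t' + s' \<le> s + t"
    by (simp_all add: funpow_add)
  then show ?thesis unfolding reach_def by blast
qed

definition code_at :: "instr list \<Rightarrow> nat \<Rightarrow> instr list \<Rightarrow> bool" where
  "code_at P pc c \<longleftrightarrow> (\<forall>i<length c. pc + i < length P \<and> P ! (pc + i) = c ! i)"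

lemma code_at_Nil [simp]: "code_at P pc []"
  by (simp add: code_at_def)

lemma code_at_Cons [simp]:
  "code_at P pc (i # c) \<longleftrightarrow> pc < length P \<and> P ! pc = i \<and> code_at P (Suc pc) c"
  unfolding code_at_def by (auto simp: All_less_Suc2 less_Suc_eq_0_disj)

lemma code_at_append [simp]:
  "code_at P pc (c @ c') \<longleftrightarrow> code_at P pc c \<and> code_at P (pc + length c) c'"
  by (induction c arbitrary: pc) auto

lemma reach_step:
  assumes "pc < length P" "exec_instr x (P ! pc) (pc, X) = c"
  shows "reach P x 1 (pc, X) c"
  unfolding reach_def using assms by (intro exI[of _ 1]) (simp add: step_def halted_def)

lemma reach_stepI:
  assumes "reach P x t c (pc, X)" "pc < length P" "exec_instr x (P ! pc) (pc, X) = c'"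
  shows "reach P x (Suc t) c c'"
  using reach_trans[OF assms(1) reach_step[OF assms(2,3)]] by simp

text \<open>The registers from \<open>d\<close> on act as an evaluation stack: the first operand
  stays in \<open>d\<close> while the second is computed from \<open>Suc d\<close> on. Preservation
  of the lower registers carries variables and constants through the induction.\<close>

lemma compile_correct:
  assumes "code_at P pc (compile pc m d e)" "\<And>v. m v < d" "3 \<le> d"
    and "\<And>v. X (m v) = \<rho> v" "X 0 = 0" "X 1 = 1" "X 2 = Suc (length x)"
  shows "\<exists>X'. reach P x (poly (cost e) (length x)) (pc, X) (pc + length (compile pc m d e), X') \<and>
    X' d = eval x \<rho> e \<and> (\<forall>r<d. X' r = X r)"
  using assms
proof (induction e arbitrary: pc m d X \<rho>)
  case (Var v)
  have "reach P x 1 (pc, X) (Suc pc, X(d := \<rho> v))"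
    using Var.prems by (intro reach_step) auto
  then show ?case
    by (intro exI[of _ "X(d := \<rho> v)"]) (simp del: fun_upd_apply add: fun_upd_same fun_upd_other)
next
  case (Cst c)
  have "reach P x 1 (pc, X) (Suc pc, X(d := c))"
    using Cst.prems by (intro reach_step) auto
  then show ?case
    by (intro exI[of _ "X(d := c)"]) (simp del: fun_upd_apply add: fun_upd_same fun_upd_other)
next
  case (Plus a b)
  let ?pc = "pc + length (compile pc m d a)"
  let ?pc' = "?pc + length (compile ?pc m (Suc d) b)"
  obtain X1 where 1: "reach P x (poly (cost a) (length x)) (pc, X) (?pc, X1)"
    "X1 d = eval x \<rho> a" "\<And>r. r < d \<Longrightarrow> X1 r = X r"
    using Plus.IH(1)[of pc m d X \<rho>] Plus.prems by (auto simp: Let_def)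
  have "m v < Suc d" "X1 (m v) = \<rho> v" for v
    using 1(3)[of "m v"] Plus.prems by (auto simp: less_SucI)
  then obtain X2 where 2: "reach P x (poly (cost b) (length x)) (?pc, X1) (?pc', X2)"
    "X2 (Suc d) = eval x \<rho> b" "\<And>r. r < Suc d \<Longrightarrow> X2 r = X1 r"
    using Plus.IH(2)[of ?pc m "Suc d" X1 \<rho>] Plus.prems 1 by (auto simp: Let_def)
  have "reach P x (Suc (poly (cost a) (length x) + poly (cost b) (length x))) (pc, X)
      (Suc ?pc', X2(d := X2 d + X2 (Suc d)))"
    by (rule reach_stepI[OF reach_trans[OF 1(1) 2(1)]])
      (use Plus.prems in \<open>auto simp: Let_def add.assoc\<close>)
  then show ?case using 1 2
    by (intro exI[of _ "X2(d := X2 d + X2 (Suc d))"])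
      (auto simp: Let_def add.assoc fun_upd_same fun_upd_other simp del: fun_upd_apply)
next
  case (Minus a b)
  let ?pc = "pc + length (compile pc m d a)"
  let ?pc' = "?pc + length (compile ?pc m (Suc d) b)"
  obtain X1 where 1: "reach P x (poly (cost a) (length x)) (pc, X) (?pc, X1)"
    "X1 d = eval x \<rho> a" "\<And>r. r < d \<Longrightarrow> X1 r = X r"
    using Minus.IH(1)[of pc m d X \<rho>] Minus.prems by (auto simp: Let_def)
  have "m v < Suc d" "X1 (m v) = \<rho> v" for v
    using 1(3)[of "m v"] Minus.prems by (auto simp: less_SucI)
  then obtain X2 where 2: "reach P x (poly (cost b) (length x)) (?pc, X1) (?pc', X2)"
    "X2 (Suc d) = eval x \<rho> b" "\<And>r. r < Suc d \<Longrightarrow> X2 r = X1 r"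
    using Minus.IH(2)[of ?pc m "Suc d" X1 \<rho>] Minus.prems 1 by (auto simp: Let_def)
  have "reach P x (Suc (poly (cost a) (length x) + poly (cost b) (length x))) (pc, X)
      (Suc ?pc', X2(d := X2 d - X2 (Suc d)))"
    by (rule reach_stepI[OF reach_trans[OF 1(1) 2(1)]])
      (use Minus.prems in \<open>auto simp: Let_def add.assoc\<close>)
  then show ?case using 1 2
    by (intro exI[of _ "X2(d := X2 d - X2 (Suc d))"])
      (auto simp: Let_def add.assoc fun_upd_same fun_upd_other simp del: fun_upd_apply)
next
  case (Bit a)
  let ?pc = "pc + length (compile pc m d a)"
  obtain X1 where 1: "reach P x (poly (cost a) (length x)) (pc, X) (?pc, X1)"
    "X1 d = eval x \<rho> a" "\<And>r. r < d \<Longrightarrow> X1 r = X r"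
    using Bit.IH[of pc m d X \<rho>] Bit.prems by auto
  have "reach P x (Suc (poly (cost a) (length x))) (pc, X) (Suc ?pc, X1(d := input_at x (X1 d)))"
    by (rule reach_stepI[OF 1(1)]) (use Bit.prems in auto)
  then show ?case using 1 by (intro exI[of _ "X1(d := input_at x (X1 d))"])
      (auto simp: fun_upd_same fun_upd_other simp del: fun_upd_apply)
next
  case (Bind v a b)
  let ?pc = "pc + length (compile pc m d a)"
  let ?pc' = "?pc + length (compile ?pc (m(v := d)) (Suc d) b)"
  obtain X1 where 1: "reach P x (poly (cost a) (length x)) (pc, X) (?pc, X1)"
    "X1 d = eval x \<rho> a" "\<And>r. r < d \<Longrightarrow> X1 r = X r"
    using Bind.IH(1)[of pc m d X \<rho>] Bind.prems by (auto simp: Let_def)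
  have "(m(v := d)) u < Suc d" "X1 ((m(v := d)) u) = (\<rho>(v := eval x \<rho> a)) u" for u
    using 1(2) 1(3)[of "m u"] Bind.prems by (auto simp: less_SucI)
  then obtain X2 where 2: "reach P x (poly (cost b) (length x)) (?pc, X1) (?pc', X2)"
    "X2 (Suc d) = eval x \<rho> (Bind v a b)" "\<And>r. r < Suc d \<Longrightarrow> X2 r = X1 r"
    using Bind.IH(2)[of ?pc "m(v := d)" "Suc d" X1 "\<rho>(v := eval x \<rho> a)"] Bind.prems 1
    by (auto simp: Let_def simp del: fun_upd_apply)
  have "reach P x (Suc (poly (cost a) (length x) + poly (cost b) (length x))) (pc, X)
      (Suc ?pc', X2(d := X2 (Suc d)))"
    by (rule reach_stepI[OF reach_trans[OF 1(1) 2(1)]])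
      (use Bind.prems 1 2 in \<open>auto simp: Let_def add.assoc\<close>)
  then show ?case using 1 2
    by (intro exI[of _ "X2(d := X2 (Suc d))"])
      (auto simp: Let_def add.assoc fun_upd_same fun_upd_other simp del: fun_upd_apply)
next
  case (Rec v w a b)
  let ?N = "Suc (length x)"
  let ?pc = "pc + length (compile pc m d a)"
  let ?m = "m(v := d, w := Suc d)"
  let ?cb = "compile (Suc ?pc) ?m (Suc (Suc d)) b"
  let ?pc' = "Suc ?pc + length ?cb"
  let ?F = "\<lambda>j. rec_nat (eval x \<rho> a) (\<lambda>j z. eval x (\<rho>(v := z, w := j)) b) j"
  let ?tb = "poly (cost b) (length x) + 4"
  have code: "code_at P (Suc ?pc) ?cb" "?pc < length P" "P ! ?pc = Const (Suc d) 0"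
    "?pc' + 3 < length P" "P ! ?pc' = Add d (Suc (Suc d)) 0"
    "P ! Suc ?pc' = Add (Suc d) (Suc d) 1" "P ! Suc (Suc ?pc') = Sub (Suc (Suc d)) 2 (Suc d)"
    "P ! Suc (Suc (Suc ?pc')) = Jump (Suc (Suc d)) (Suc ?pc)"
    using Rec.prems(1) by (auto simp: Let_def add.assoc)
  obtain X1 where 1: "reach P x (poly (cost a) (length x)) (pc, X) (?pc, X1)"
    "X1 d = eval x \<rho> a" "\<And>r. r < d \<Longrightarrow> X1 r = X r"
    using Rec.IH(1)[of pc m d X \<rho>] Rec.prems by (auto simp: Let_def)
  let ?X0 = "X1(Suc d := 0)"
  \<comment> \<open>Loop invariant: after \<open>j\<close> passes, \<open>d\<close> holds the
    accumulator and \<open>Suc d\<close> the counter. The scratch register receives the truncated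
    \<open>?N - Suc j\<close>, so the jump is taken iff another pass is due.\<close>
  have body: "\<exists>Y'. reach P x ?tb (Suc ?pc, Y) (if Suc j < ?N then Suc ?pc else ?pc' + 4, Y') \<and>
      Y' d = ?F (Suc j) \<and> Y' (Suc d) = Suc j \<and> (\<forall>r<d. Y' r = X r)"
    if Y: "Y d = ?F j" "Y (Suc d) = j" "\<forall>r<d. Y r = X r" for j Y
  proof -
    have M: "?m u < Suc (Suc d)" "Y (?m u) = (\<rho>(v := ?F j, w := j)) u" for u
      using Y Rec.prems(2)[of u] Rec.prems(4)[of u] by auto
    have "3 \<le> Suc (Suc d)" "Y 0 = 0" "Y 1 = 1" "Y 2 = ?N"
      using Y(3) Rec.prems by auto
    from Rec.IH(2)[OF code(1) M(1) this(1) M(2) this(2-4)]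
    obtain Z where Z: "reach P x (poly (cost b) (length x)) (Suc ?pc, Y) (?pc', Z)"
      "Z (Suc (Suc d)) = ?F (Suc j)" "\<And>r. r < Suc (Suc d) \<Longrightarrow> Z r = Y r"
      by (auto simp del: fun_upd_apply)
    have Z0: "Z 0 = 0" "Z 1 = 1" "Z 2 = ?N" "Z (Suc d) = j" "\<And>r. r < d \<Longrightarrow> Z r = X r"
      using Z(3) Y Rec.prems by auto
    let ?Z1 = "Z(d := ?F (Suc j))"
    let ?Z2 = "?Z1(Suc d := Suc j)"
    let ?Z3 = "?Z2(Suc (Suc d) := ?N - Suc j)"
    have "reach P x (Suc (poly (cost b) (length x))) (Suc ?pc, Y) (Suc ?pc', ?Z1)"
      using code Z(2) Z0 by (intro reach_stepI[OF Z(1)]) auto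
    from reach_stepI[OF this, of "(Suc (Suc ?pc'), ?Z2)"]
    have "reach P x (Suc (Suc (poly (cost b) (length x)))) (Suc ?pc, Y) (Suc (Suc ?pc'), ?Z2)"
      using code Z0 Rec.prems(3) by auto
    from reach_stepI[OF this, of "(Suc (Suc (Suc ?pc')), ?Z3)"]
    have "reach P x (Suc (Suc (Suc (poly (cost b) (length x))))) (Suc ?pc, Y)
        (Suc (Suc (Suc ?pc')), ?Z3)"
      using code Z0 Rec.prems(3) by auto
    from reach_stepI[OF this, of "(if Suc j < ?N then Suc ?pc else ?pc' + 4, ?Z3)"]
    have "reach P x ?tb (Suc ?pc, Y) (if Suc j < ?N then Suc ?pc else ?pc' + 4, ?Z3)"
      using code by (auto simp: numeral_eq_Suc)
    then show ?thesis using Z0 by (intro exI[of _ ?Z3]) auto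
  qed
  \<comment> \<open>The loop tests after its body and thus makes at least one pass, which fits
    because \<open>?N\<close> is positive.\<close>
  have loop: "\<exists>Y. reach P x (Suc j * ?tb) (Suc ?pc, ?X0)
        (if Suc j < ?N then Suc ?pc else ?pc' + 4, Y) \<and>
      Y d = ?F (Suc j) \<and> Y (Suc d) = Suc j \<and> (\<forall>r<d. Y r = X r)" if "j < ?N" for j
    using that
  proof (induction j)
    case 0
    have "?X0 d = ?F 0" "?X0 (Suc d) = 0" "\<forall>r<d. ?X0 r = X r" using 1 by auto
    from body[OF this] show ?case by (simp only: mult_1 One_nat_def[symmetric])
  next
    case (Suc j)
    then obtain Y where Y: "reach P x (Suc j * ?tb) (Suc ?pc, ?X0) (Suc ?pc, Y)"
      "Y d = ?F (Suc j)" "Y (Suc d) = Suc j" "\<forall>r<d. Y r = X r"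
      by (auto simp del: fun_upd_apply)
    obtain Y' where Y': "reach P x ?tb (Suc ?pc, Y)
        (if Suc (Suc j) < ?N then Suc ?pc else ?pc' + 4, Y')"
      "Y' d = ?F (Suc (Suc j))" "Y' (Suc d) = Suc (Suc j)" "\<forall>r<d. Y' r = X r"
      using body[OF Y(2-4)] by blast
    have "reach P x (Suc (Suc j) * ?tb) (Suc ?pc, ?X0)
        (if Suc (Suc j) < ?N then Suc ?pc else ?pc' + 4, Y')"
      using reach_trans[OF Y(1) Y'(1)] by (simp only: mult_Suc add.commute)
    then show ?case using Y' by blast
  qed
  obtain Y where Y: "reach P x (?N * ?tb) (Suc ?pc, ?X0) (?pc' + 4, Y)"
    "Y d = ?F ?N" "\<forall>r<d. Y r = X r"
    using loop[of "length x"] by auto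
  have "reach P x (Suc (poly (cost a) (length x))) (pc, X) (Suc ?pc, ?X0)"
    by (rule reach_stepI[OF 1(1)]) (use code in auto)
  from reach_trans[OF this Y(1)]
  have "reach P x (poly (cost (Rec v w a b)) (length x)) (pc, X) (?pc' + 4, Y)"
    by (auto elim!: reach_mono simp: algebra_simps)
  moreover have "pc + length (compile pc m d (Rec v w a b)) = ?pc' + 4"
    by (simp add: Let_def)
  moreover have "Y d = eval x \<rho> (Rec v w a b)" using Y(2) by (simp only: eval.simps)
  ultimately show ?case using Y(3) by metis
qed

text \<open>The prelude scans up to the end marker: 2 minus the symbol read is positive before it
  and 0 at it. Register 2 is incremented before the jump, hence ends as
  \<open>Suc (length x)\<close>. Unbound variables map to register 0, matching the all-zero
  environment.\<close>

definition program :: "expr \<Rightarrow> instr list" where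
  "program e = [Const 1 1, Const 4 2, Read 3 2, Add 2 2 1, Sub 3 4 3, Jump 3 2] @
     compile 6 (\<lambda>_. 0) 3 e @ [Add 0 3 0]"

text \<open>The time consists of two initial instructions, \<open>Suc (length x)\<close> scanning
  passes of 4 instructions each, the compiled code and the final copy.\<close>

lemma program_correct:
  "\<exists>X. reach (program e) x (7 + 4 * length x + poly (cost e) (length x)) (0, \<lambda>_. 0)
      (length (program e), X) \<and> X 0 = eval x (\<lambda>_. 0) e"
proof -
  let ?P = "program e"
  have "code_at ?P 0 ([Const 1 1, Const 4 2, Read 3 2, Add 2 2 1, Sub 3 4 3, Jump 3 2] @
      compile 6 (\<lambda>_. 0) 3 e @ [Add 0 3 0])"
    unfolding code_at_def program_def by simp
  then have code: "code_at ?P 6 (compile 6 (\<lambda>_. 0) 3 e)"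
    "code_at ?P (6 + length (compile 6 (\<lambda>_. 0) 3 e)) [Add 0 3 0]"
    by (simp_all only: code_at_append) (simp_all add: numeral_eq_Suc)
  have ins: "\<forall>i<6. i < length ?P" "?P ! 0 = Const 1 1" "?P ! 1 = Const 4 2" "?P ! 2 = Read 3 2"
    "?P ! 3 = Add 2 2 1" "?P ! 4 = Sub 3 4 3" "?P ! 5 = Jump 3 2" "?P \<noteq> []"
    by (auto simp: program_def)
  \<comment> \<open>The registers on entering address 2 with \<open>j\<close> positions scanned;
    register 3 is scratch.\<close>
  define I where "I j X \<longleftrightarrow> X 0 = 0 \<and> X 1 = 1 \<and> X 4 = 2 \<and> X 2 = j" for j :: nat and X :: "nat \<Rightarrow> nat"
  have body: "\<exists>Y. reach ?P x 4 (2, X) (if j < length x then 2 else 6, Y) \<and> I (Suc j) Y"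
    if "I j X" for j X
  proof -
    let ?X1 = "X(3 := input_at x j)"
    let ?X2 = "?X1(2 := Suc j)"
    let ?X3 = "?X2(3 := 2 - input_at x j)"
    have "reach ?P x 1 (2, X) (3, ?X1)"
      using that ins by (intro reach_step) (auto simp: I_def)
    from reach_stepI[OF this, of "(4, ?X2)"]
    have "reach ?P x 2 (2, X) (4, ?X2)"
      using that ins by (auto simp: I_def numeral_eq_Suc)
    from reach_stepI[OF this, of "(5, ?X3)"]
    have "reach ?P x 3 (2, X) (5, ?X3)"
      using that ins by (auto simp: I_def)
    from reach_stepI[OF this, of "(if j < length x then 2 else 6, ?X3)"]
    have "reach ?P x 4 (2, X) (if j < length x then 2 else 6, ?X3)"
      using that ins by (auto simp: I_def input_at_def)
    then show ?thesis using that by (intro exI[of _ ?X3]) (auto simp: I_def)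
  qed
  let ?X0 = "(\<lambda>_. 0)(1 := 1, 4 := 2) :: nat \<Rightarrow> nat"
  have loop: "\<exists>Y. reach ?P x (4 * Suc j) (2, ?X0) (if j < length x then 2 else 6, Y) \<and> I (Suc j) Y"
    if "j \<le> length x" for j
    using that
  proof (induction j)
    case 0
    have "I 0 ?X0" by (simp add: I_def)
    from body[OF this] show ?case by (simp del: fun_upd_apply)
  next
    case (Suc j)
    then obtain Y where Y: "reach ?P x (4 * Suc j) (2, ?X0) (2, Y)" "I (Suc j) Y"
      by (auto simp del: fun_upd_apply)
    obtain Z where Z: "reach ?P x 4 (2, Y) (if Suc j < length x then 2 else 6, Z)"
      "I (Suc (Suc j)) Z" using body[OF Y(2)] by blast
    from reach_trans[OF Y(1) Z(1)] Z(2) show ?case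
      by (auto simp: add.commute simp del: fun_upd_apply)
  qed
  obtain Y where Y: "reach ?P x (4 * Suc (length x)) (2, ?X0) (6, Y)" "I (Suc (length x)) Y"
    using loop[of "length x"] by auto
  have "reach ?P x 1 (0, \<lambda>_. 0) (1, (\<lambda>_. 0)(1 := 1))"
    using ins by (intro reach_step) auto
  from reach_stepI[OF this, of "(2, ?X0)"]
  have "reach ?P x 2 (0, \<lambda>_. 0) (2, ?X0)"
    using ins by (auto simp: numeral_eq_Suc)
  from reach_trans[OF this Y(1)]
  have 1: "reach ?P x (2 + 4 * Suc (length x)) (0, \<lambda>_. 0) (6, Y)" .
  obtain Z where Z: "reach ?P x (poly (cost e) (length x)) (6, Y)
      (6 + length (compile 6 (\<lambda>_. 0) 3 e), Z)" "Z 3 = eval x (\<lambda>_. 0) e" "\<forall>r<3. Z r = Y r"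
    using compile_correct[OF code(1), of Y "\<lambda>_. 0" x] Y(2) unfolding I_def by auto
  have "Z 0 = 0" using Z(3) Y(2) by (simp add: I_def)
  then have "reach ?P x (Suc (2 + 4 * Suc (length x) + poly (cost e) (length x))) (0, \<lambda>_. 0)
      (Suc (6 + length (compile 6 (\<lambda>_. 0) 3 e)), Z(0 := Z 3))"
    using code(2) by (intro reach_stepI[OF reach_trans[OF 1 Z(1)]]) auto
  then show ?thesis using Z(2)
    by (intro exI[of _ "Z(0 := Z 3)"]) (simp add: program_def numeral_eq_Suc)
qed

text \<open>The machine may halt before the polynomial bound is exhausted; the halting configuration
  then repeats, so the answer is still present at the end.\<close>

lemma polynomial_timeI:
  assumes "\<And>x. eval x (\<lambda>_. 0) e = of_bool (x \<in> K)"
  shows "polynomial_time K"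
proof -
  let ?P = "program e"
  let ?p = "[:7, 4:] + cost e"
  have "halted ?P (run ?P x (poly ?p (length x))) \<and>
      snd (run ?P x (poly ?p (length x))) 0 = (if x \<in> K then 1 else 0)" for x
  proof -
    obtain X s where X: "s \<le> poly ?p (length x)" "X 0 = eval x (\<lambda>_. 0) e"
      "(step ?P x ^^ s) (0, \<lambda>_. 0) = (length ?P, X)"
      using program_correct[of e x] by (auto simp: reach_def algebra_simps)
    have stay: "(step ?P x ^^ t) (length ?P, X) = (length ?P, X)" for t
      by (induction t) (auto simp: step_def halted_def)
    obtain t where "poly ?p (length x) = t + s"
      using X(1) by (metis le_add_diff_inverse2)
    then have "run ?P x (poly ?p (length x)) = (length ?P, X)"
      using X(3) stay[of t] unfolding run_def by (simp add: funpow_add)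
    then show ?thesis using X(2) assms[of x] by (simp add: halted_def)
  qed
  then show ?thesis unfolding polynomial_time_def decides_in_time_def Let_def by blast
qed


section \<open>Synchronizing words of commutative automata\<close>

text \<open>Induction on the set \<open>S\<close> of free coordinates, the others being fixed by
  \<open>base\<close>. If all vectors constant on \<open>S\<close> lie in \<open>D\<close>, one
  ideal suffices. Otherwise some constant \<open>n\<close> is excluded, so every \<open>f\<close>
  considered has a coordinate in \<open>S\<close> below \<open>n\<close>; fixing its value leaves
  finitely many smaller cases.\<close>

lemma downward_closed_finite_ideals:
  fixes D :: "('a \<Rightarrow> nat) set"
  assumes "finite S" and down: "\<forall>g\<in>D. \<forall>f\<le>g. f \<in> D"
  shows "\<exists>J. finite J \<and> (\<forall>(c, B)\<in>J. \<forall>n. (\<lambda>a. if a \<in> B then n else c a) \<in> D) \<and>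
    (\<forall>f\<in>D. (\<forall>a. a \<notin> S \<longrightarrow> f a = base a) \<longrightarrow> (\<exists>(c, B)\<in>J. \<forall>a. a \<notin> B \<longrightarrow> f a \<le> c a))"
  using assms(1)
proof (induction S arbitrary: base rule: finite_psubset_induct)
  case (psubset S)
  show ?case
  proof (cases "\<forall>n. (\<lambda>a. if a \<in> S then n else base a) \<in> D")
    case True
    then show ?thesis by (intro exI[of _ "{(base, S)}"]) auto
  next
    case False
    then obtain n where n: "(\<lambda>a. if a \<in> S then n else base a) \<notin> D" by blast
    \<comment> \<open>The claim for one coordinate \<open>a\<close> fixed to \<open>i\<close>, named
      so that the witnesses can be chosen for all \<open>a\<close> and \<open>i\<close> at
      once.\<close>
    define good where "good a i J \<longleftrightarrow> finite J \<and>
        (\<forall>(c, B)\<in>J. \<forall>n. (\<lambda>a. if a \<in> B then n else c a) \<in> D) \<and>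
        (\<forall>f\<in>D. (\<forall>b. b \<notin> S - {a} \<longrightarrow> f b = (base(a := i)) b) \<longrightarrow>
          (\<exists>(c, B)\<in>J. \<forall>a. a \<notin> B \<longrightarrow> f a \<le> c a))" for a i J
    have "\<exists>J. good a i J" if "a \<in> S" for a i
      unfolding good_def using that by (intro psubset.IH) auto
    then obtain J where J: "\<And>a i. a \<in> S \<Longrightarrow> good a i (J a i)"
      by metis
    let ?J = "\<Union>a\<in>S. \<Union>i<n. J a i"
    have 1: "\<exists>(c, B)\<in>?J. \<forall>a. a \<notin> B \<longrightarrow> f a \<le> c a"
      if f: "f \<in> D" "\<forall>a. a \<notin> S \<longrightarrow> f a = base a" for f
    proof -
      \<comment> \<open>Otherwise \<open>f\<close> would dominate the excluded vector and force it
        into \<open>D\<close>.\<close>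
      have "\<exists>a\<in>S. f a < n"
      proof (rule ccontr)
        assume "\<not> (\<exists>a\<in>S. f a < n)"
        then have "(\<lambda>a. if a \<in> S then n else base a) \<le> f"
          using f(2) by (auto simp: le_fun_def)
        then show False using down f(1) n by blast
      qed
      then obtain a where a: "a \<in> S" "f a < n" by blast
      have "\<exists>(c, B)\<in>J a (f a). \<forall>a. a \<notin> B \<longrightarrow> f a \<le> c a"
        by (rule J[OF a(1), unfolded good_def, THEN conjunct2, THEN conjunct2, THEN bspec, OF f(1),
              THEN mp])
          (use f(2) in auto)
      then show ?thesis using a by (elim bexE) (rule bexI, assumption, blast)
    qed
    have 2: "finite ?J" using J[unfolded good_def, THEN conjunct1] psubset.hyps(1) by simp
    have 3: "\<forall>(c, B)\<in>?J. \<forall>n. (\<lambda>a. if a \<in> B then n else c a) \<in> D"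
    proof
      fix j assume "j \<in> ?J"
      then obtain a i where "a \<in> S" "j \<in> J a i" by blast
      then show "case j of (c, B) \<Rightarrow> \<forall>n. (\<lambda>a. if a \<in> B then n else c a) \<in> D"
        by (rule J[unfolded good_def, THEN conjunct2, THEN conjunct1, THEN bspec])
    qed
    show ?thesis by (intro exI[of _ ?J] conjI ballI impI 1 2 bspec[OF 3])
  qed
qed

text \<open>If \<open>f\<close> maps \<open>Q\<close> onto itself, all powers have image
  \<open>Q\<close>. Otherwise the image is strictly smaller, and the induction hypothesis applies to
  it with both exponents lowered by one.\<close>

lemma funpow_image_stable:
  assumes "finite Q" "f ` Q \<subseteq> Q" "card Q \<le> m" "card Q \<le> n"
  shows "(f ^^ m) ` Q = (f ^^ n) ` Q"
  using assms
proof (induction Q arbitrary: m n rule: finite_psubset_induct)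
  case (psubset Q)
  show ?case
  proof (cases "f ` Q = Q")
    case True
    have "(f ^^ k) ` Q = Q" for k
    proof (induction k)
      case (Suc k)
      have "(f ^^ Suc k) ` Q = f ` (f ^^ k) ` Q" by (simp add: image_comp)
      then show ?case using Suc True by simp
    qed simp
    then show ?thesis by simp
  next
    case False
    then have "f ` Q \<subset> Q" using psubset.prems by blast
    then have less: "card (f ` Q) < card Q" by (simp add: psubset.hyps psubset_card_mono)
    with psubset.prems obtain m' n' where mn: "m = Suc m'" "n = Suc n'"
      by (metis less_zeroE not0_implies_Suc le_zero_eq not_less_zero)
    have "(f ^^ m') ` f ` Q = (f ^^ n') ` f ` Q"
      using \<open>f ` Q \<subset> Q\<close> less psubset.prems mn by (intro psubset.IH) auto
    then show ?thesis by (simp add: mn image_comp funpow_Suc_right del: funpow.simps)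
  qed
qed

section \<open>Letter counts and synchronization\<close>

lemma trans_word_append: "trans_word A q (u @ v) = trans_word A (trans_word A q u) v"
  by (simp add: trans_word_def)

lemma trans_word_replicate: "trans_word A q (replicate n a) = ((\<lambda>q. trans A q a) ^^ n) q"
  by (induction n arbitrary: q) (simp_all add: trans_word_def funpow_Suc_right del: funpow.simps(2))

lemma trans_set_append: "trans_set A S (u @ v) = trans_set A (trans_set A S u) v"
  by (simp add: trans_set_def trans_word_append image_comp comp_def)

context
  fixes A :: "('q, 'a) semi_automaton"
  assumes semi: "is_semi_automaton A" and comm: "commutative A"
begin

lemma trans_word_mset_cong:
  assumes "q \<in> states A" "u \<in> lists (alphabet A)" "mset u = mset v"
  shows "trans_word A q u = trans_word A q v"
proof -
  \<comment> \<open>Extending each letter by the identity outside the states makes the letters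
    commute as total functions, as multiset invariance of \<open>fold\<close> requires.\<close>
  let ?f = "\<lambda>a q. if q \<in> states A then trans A q a else q"
  have eq: "trans_word A p w = fold ?f w p" if "p \<in> states A" "w \<in> lists (alphabet A)" for p w
    using that semi
    by (induction w arbitrary: p) (auto simp: trans_word_def is_semi_automaton_def)
  have "set v = set u" using assms(3) by (metis set_mset_mset)
  then have v: "v \<in> lists (alphabet A)" using assms(2) by auto
  have "?f a \<circ> ?f b = ?f b \<circ> ?f a" if "a \<in> set u" "b \<in> set u" for a b
  proof
    fix p
    have "a \<in> alphabet A" "b \<in> alphabet A" using that assms(2) by auto
    then show "(?f a \<circ> ?f b) p = (?f b \<circ> ?f a) p"
      using semi comm
      by (cases "p \<in> states A")
        (simp_all add: is_semi_automaton_def commutative_def trans_word_def)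
  qed
  then have "fold ?f u = fold ?f v" by (rule fold_multiset_equiv) (use assms(3) in auto)
  then show ?thesis using eq assms(1,2) v by simp
qed

text \<open>By commutativity \<open>w\<close> acts as \<open>u\<close> followed by the remaining
  letters, and the image of a singleton is a singleton.\<close>

lemma synchronizing_mono:
  assumes "synchronizing A u" "mset u \<subseteq># mset w" "w \<in> lists (alphabet A)"
  shows "synchronizing A w"
proof -
  obtain r where r: "mset w = mset (u @ r)"
    using assms(2) by (metis ex_mset mset_append subset_mset.add_diff_inverse)
  have "trans_set A (states A) w = trans_set A (states A) (u @ r)"
    unfolding trans_set_def using trans_word_mset_cong[OF _ assms(3) r] by (auto intro!: image_cong)
  also have "\<dots> = trans_set A (trans_set A (states A) u) r"
    by (rule trans_set_append)
  finally have "card (trans_set A (states A) w) = 1"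
    using assms(1) by (auto simp: synchronizing_def card_1_singleton_iff trans_set_def)
  then show ?thesis using assms(3) by (simp add: synchronizing_def)
qed

text \<open>A letter occurring more often than there are states can be dropped once, since its powers
  have by then reached their final image.\<close>

lemma synchronizing_reduce:
  assumes "synchronizing A w"
  shows "\<exists>u. synchronizing A u \<and> mset u \<subseteq># mset w \<and> (\<forall>a. count (mset u) a \<le> card (states A))"
  using assms
proof (induction w rule: measure_induct_rule[of length])
  case (less w)
  show ?case
  proof (cases "\<forall>a. count (mset w) a \<le> card (states A)")
    case True
    then show ?thesis using less.prems by blast
  next
    case False
    then obtain a m where m: "count (mset w) a = Suc m" "card (states A) \<le> m"
      by (metis not_less_eq_eq not0_implies_Suc le0)
    have w: "w \<in> lists (alphabet A)" using less.prems by (simp add: synchronizing_def)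
    \<comment> \<open>With all copies of \<open>a\<close> moved to the front, their power acts on
      the full state set, where its image is stable.\<close>
    define r where "r = filter (\<lambda>b. b \<noteq> a) w"
    have ms: "mset w = mset (replicate (Suc m) a @ r)"
    proof (rule multiset_eqI)
      fix b show "count (mset w) b = count (mset (replicate (Suc m) a @ r)) b"
        using m(1) by (auto simp: r_def)
    qed
    have a: "a \<in> alphabet A" using m(1) w by (metis count_mset_0_iff in_listsD nat.discI)
    have fin: "finite (states A)" and sub: "(\<lambda>q. trans A q a) ` states A \<subseteq> states A"
      using semi a by (auto simp: is_semi_automaton_def)
    have "trans_set A (states A) (replicate m a @ r) =
        trans_set A (states A) (replicate (Suc m) a @ r)"
      unfolding trans_set_append
      using funpow_image_stable[OF fin sub m(2) le_SucI[OF m(2)]]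
      by (simp only: trans_set_def trans_word_replicate)
    also have "\<dots> = trans_set A (states A) w"
      unfolding trans_set_def
      by (intro image_cong refl trans_word_mset_cong[OF _ w ms, symmetric])
    finally have "synchronizing A (replicate m a @ r)"
      using less.prems a by (auto simp: synchronizing_def r_def)
    moreover have "length (replicate m a @ r) < length w"
      using arg_cong[OF ms, of size] by simp
    ultimately obtain u where u: "synchronizing A u" "mset u \<subseteq># mset (replicate m a @ r)"
      "\<forall>a. count (mset u) a \<le> card (states A)"
      using less.IH by blast
    have "mset (replicate m a @ r) \<subseteq># mset w" unfolding ms by simp
    then show ?thesis using u subset_mset.order_trans by blast
  qed
qed

end

section \<open>Reduction to finitely many pumped words\<close>

definition pump :: "'a list \<Rightarrow> 'a list \<Rightarrow> nat \<Rightarrow> 'a list" where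
  "pump u v n = u @ concat (replicate n v)"

lemma pump_in_lists: "u \<in> lists S \<Longrightarrow> v \<in> lists S \<Longrightarrow> pump u v n \<in> lists S"
  by (auto simp: pump_def)

text \<open>\<open>J\<close> is quantified before \<open>A\<close> and \<open>n\<close>, so one list
  serves all inputs. Each ideal in the downward closure of the letter counts of \<open>L\<close>
  contributes one pair.\<close>

lemma finite_pumps:
  fixes L :: "'a list set"
  assumes "finite \<Sigma>" and L: "L \<subseteq> lists \<Sigma>"
  shows "\<exists>J. set J \<subseteq> lists \<Sigma> \<times> lists \<Sigma> \<and>
    (\<forall>(A :: ('q, 'a) semi_automaton) n. is_semi_automaton A \<longrightarrow> commutative A \<longrightarrow> alphabet A = \<Sigma> \<longrightarrow>
      card (states A) \<le> n \<longrightarrow>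
      ((\<exists>w\<in>L. synchronizing A w) \<longleftrightarrow> (\<exists>(u, v)\<in>set J. synchronizing A (pump u v n))))"
proof -
  obtain as where as: "distinct as" "set as = \<Sigma>"
    using finite_distinct_list[OF assms(1)] by blast
  define D where "D = {f. \<exists>w\<in>L. \<forall>a. f a \<le> count (mset w) a}"
  have "\<forall>g\<in>D. \<forall>f\<le>g. f \<in> D"
    unfolding D_def le_fun_def by (blast intro: order_trans)
  from downward_closed_finite_ideals[OF assms(1) this, where base = "\<lambda>_. 0"]
  obtain J where J: "finite J" "\<forall>(c, B)\<in>J. \<forall>n. (\<lambda>a. if a \<in> B then n else c a) \<in> D"
    "\<forall>f\<in>D. (\<forall>a. a \<notin> \<Sigma> \<longrightarrow> f a = 0) \<longrightarrow> (\<exists>(c, B)\<in>J. \<forall>a. a \<notin> B \<longrightarrow> f a \<le> c a)"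
    by (elim exE conjE)
  \<comment> \<open>For an ideal \<open>(c, B)\<close>, \<open>U\<close> realises the bounded
    entries and \<open>V\<close> has each letter of \<open>B\<close> once, so \<open>n\<close>
    copies of \<open>V\<close> give the value \<open>n\<close> on \<open>B\<close>.\<close>
  define U where "U = (\<lambda>(c :: 'a \<Rightarrow> nat, B). concat (map (\<lambda>a. replicate (c a) a) (filter (\<lambda>a. a \<notin> B) as)))"
  define V where "V = (\<lambda>(c :: 'a \<Rightarrow> nat, B). filter (\<lambda>a. a \<in> B) as)"
  have lists: "U j \<in> lists \<Sigma>" "V j \<in> lists \<Sigma>" for j
    using as(2) by (auto simp: U_def V_def split: prod.splits)
  have replicate_count: "count (mset (concat (replicate n v))) a = n * count (mset v) a" for n v and a :: 'a
    by (induction n) auto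
  have "count (mset (concat (map (\<lambda>a. replicate (c a) a) xs))) b =
      (if b \<in> set xs then c b else 0)" if "distinct xs" for c xs and b :: 'a
    using that by (induction xs) auto
  then have cnt: "count (mset (pump (U (c, B)) (V (c, B)) n)) a =
      (if a \<in> \<Sigma> then if a \<in> B then n else c a else 0)" for c B n a
    using as by (auto simp: pump_def U_def V_def replicate_count distinct_count_atmost_1)
  obtain js where js: "set js = J" using finite_list[OF J(1)] by blast
  let ?J = "map (\<lambda>j. (U j, V j)) js"
  have equiv: "(\<exists>w\<in>L. synchronizing A w) \<longleftrightarrow> (\<exists>(u, v)\<in>set ?J. synchronizing A (pump u v n))"
    if A: "is_semi_automaton A" "commutative A" "alphabet A = \<Sigma>" "card (states A) \<le> n"
    for A :: "('q, 'a) semi_automaton" and n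
  proof
    assume "\<exists>w\<in>L. synchronizing A w"
    \<comment> \<open>The reduced word \<open>u\<close> lies below a word of \<open>L\<close>, so
      its counts are in \<open>D\<close>; they are also at most \<open>n\<close>, so the value
      \<open>n\<close> on \<open>B\<close> dominates them.\<close>
    then obtain w u where w: "w \<in> L" and u: "synchronizing A u" "mset u \<subseteq># mset w"
      "\<And>a. count (mset u) a \<le> card (states A)"
      using synchronizing_reduce[OF A(1,2)] by meson
    have 0: "count (mset u) a = (0 :: nat)" if "a \<notin> \<Sigma>" for a
      using u(1) that A(3) by (auto simp: synchronizing_def count_mset_0_iff)
    have "count (mset u) \<in> D"
      using w u(2) by (auto simp: D_def subseteq_mset_def)
    then obtain c B where cB: "(c, B) \<in> J" "\<forall>a. a \<notin> B \<longrightarrow> count (mset u) a \<le> c a"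
      using J(3) 0 by blast
    have "mset u \<subseteq># mset (pump (U (c, B)) (V (c, B)) n)"
      unfolding subseteq_mset_def cnt using 0 cB(2) u(3) A(4) by (auto intro: order_trans)
    then have "synchronizing A (pump (U (c, B)) (V (c, B)) n)"
      by (rule synchronizing_mono[OF A(1,2) u(1)]) (simp add: A(3) pump_in_lists[OF lists] del: in_lists_conv_set)
    then show "\<exists>(u, v)\<in>set ?J. synchronizing A (pump u v n)" using cB(1) js by auto
  next
    assume "\<exists>(u, v)\<in>set ?J. synchronizing A (pump u v n)"
    then obtain c B where cB: "(c, B) \<in> J" "synchronizing A (pump (U (c, B)) (V (c, B)) n)"
      using js by auto
    \<comment> \<open>The vector of the pumped word is in \<open>D\<close>, hence below a word of
      \<open>L\<close>, and synchronization passes upwards.\<close>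
    then obtain w where w: "w \<in> L" "\<forall>a. (if a \<in> B then n else c a) \<le> count (mset w) a"
      using J(2) unfolding D_def by blast
    have "mset (pump (U (c, B)) (V (c, B)) n) \<subseteq># mset w"
      unfolding subseteq_mset_def cnt using w(2) by auto
    then show "\<exists>w\<in>L. synchronizing A w"
      using synchronizing_mono[OF A(1,2) cB(2)] A(3) w(1) L by (metis subsetD)
  qed
  have "set ?J \<subseteq> lists \<Sigma> \<times> lists \<Sigma>"
    by (simp add: image_subset_iff lists del: in_lists_conv_set)
  then show ?thesis
  proof (intro exI conjI allI impI)
    fix A :: "('q, 'a) semi_automaton" and n
    assume "is_semi_automaton A" "commutative A" "alphabet A = \<Sigma>" "card (states A) \<le> n"
    then show "(\<exists>w\<in>L. synchronizing A w) \<longleftrightarrow> (\<exists>(u, v)\<in>set ?J. synchronizing A (pump u v n))"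
      by (rule equiv)
  qed
qed


section \<open>Expressions reading the input\<close>

text \<open>Positive values stand for true. \<open>Imp\<close> and \<open>Disj\<close> are plain
  sums and may exceed 1; \<open>Neg\<close> normalises to 0 or 1.\<close>

definition Neg :: "expr \<Rightarrow> expr" where
  "Neg a = Minus (Cst 1) a"

lemma eval_Neg [simp]: "eval x \<rho> (Neg a) = of_bool (eval x \<rho> a = 0)"
  by (simp add: Neg_def)

definition And :: "expr \<Rightarrow> expr \<Rightarrow> expr" where
  "And a b = Neg (Plus (Neg a) (Neg b))"

definition Imp :: "expr \<Rightarrow> expr \<Rightarrow> expr" where
  "Imp a b = Plus (Neg a) b"

definition Less :: "expr \<Rightarrow> expr \<Rightarrow> expr" where
  "Less a b = Neg (Minus (Plus a (Cst 1)) b)"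

definition Equal :: "expr \<Rightarrow> expr \<Rightarrow> expr" where
  "Equal a b = Neg (Plus (Minus a b) (Minus b a))"

definition Disj :: "expr list \<Rightarrow> expr" where
  "Disj es = foldr Plus es (Cst 0)"

definition Conj :: "expr list \<Rightarrow> expr" where
  "Conj es = Neg (Disj (map Neg es))"

lemma eval_logic [simp]:
  "eval x \<rho> (And a b) = of_bool (0 < eval x \<rho> a \<and> 0 < eval x \<rho> b)"
  "0 < eval x \<rho> (Imp a b) \<longleftrightarrow> (0 < eval x \<rho> a \<longrightarrow> 0 < eval x \<rho> b)"
  "eval x \<rho> (Less a b) = of_bool (eval x \<rho> a < eval x \<rho> b)"
  "eval x \<rho> (Equal a b) = of_bool (eval x \<rho> a = eval x \<rho> b)"
  by (auto simp: And_def Imp_def Less_def Equal_def)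

lemma eval_Disj [simp]: "0 < eval x \<rho> (Disj es) \<longleftrightarrow> (\<exists>e\<in>set es. 0 < eval x \<rho> e)"
  unfolding Disj_def by (induction es) auto

lemma eval_Conj [simp]: "eval x \<rho> (Conj es) = of_bool (\<forall>e\<in>set es. 0 < eval x \<rho> e)"
  using eval_Disj[of x \<rho> "map Neg es"] by (auto simp: Conj_def)

text \<open>Variable 0 is reserved for the accumulator, so the body of a sum must not depend on it.\<close>

definition Sum_below :: "nat \<Rightarrow> expr \<Rightarrow> expr" where
  "Sum_below v e = Rec 0 v (Cst 0) (Plus (Var 0) e)"

definition Forall :: "nat \<Rightarrow> expr \<Rightarrow> expr" where
  "Forall v e = Neg (Sum_below v (Neg e))"

lemma eval_Sum_below:
  assumes "\<And>\<rho> z. eval x (\<rho>(0 := z)) e = eval x \<rho> e" "v \<noteq> 0"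
  shows "eval x \<rho> (Sum_below v e) = (\<Sum>i<Suc (length x). eval x (\<rho>(v := i)) e)"
proof -
  have "eval x (\<rho>(0 := z, v := i)) e = eval x (\<rho>(v := i)) e" for z i
    using assms by (metis fun_upd_twist)
  then have "rec_nat 0 (\<lambda>j z. z + eval x (\<rho>(0 := z, v := j)) e) n = (\<Sum>i<n. eval x (\<rho>(v := i)) e)" for n
    by (induction n) simp_all
  then show ?thesis using assms(2) by (simp add: Sum_below_def del: old.nat.rec sum.lessThan_Suc)
qed

text \<open>\<open>Neg\<close> normalises the body before summation, so independence of variable 0
  is required of its truth value only.\<close>

lemma eval_Forall:
  assumes "\<And>\<rho> z. 0 < eval x (\<rho>(0 := z)) e \<longleftrightarrow> 0 < eval x \<rho> e" "v \<noteq> 0"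
  shows "eval x \<rho> (Forall v e) = of_bool (\<forall>i\<le>length x. 0 < eval x (\<rho>(v := i)) e)"
proof -
  have "eval x (\<rho>(0 := z)) (Neg e) = eval x \<rho> (Neg e)" for \<rho> z
    using assms(1)[of \<rho> z] by simp
  from eval_Sum_below[OF this assms(2)] show ?thesis
    by (auto simp: Forall_def less_Suc_eq_le simp del: sum.lessThan_Suc)
qed

section \<open>Counting and decoding unary numbers\<close>

definition Len :: expr where
  "Len = Sum_below 1 (Cst 1)"

lemma eval_Len [simp]: "eval x \<rho> Len = Suc (length x)"
  by (simp add: Len_def eval_Sum_below)

text \<open>The sum has the fixed range of a loop, with the condition \<open>r < p\<close> moved
  into the summand, to match \<open>Sum_below\<close>.\<close>

definition zeros :: "bool list \<Rightarrow> nat \<Rightarrow> nat" where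
  "zeros x p = (\<Sum>r<Suc (length x). of_bool (r < p \<and> input_at x r = 0))"

text \<open>The \<open>j\<close>-th number of a concatenation of unary numbers is the number of ones preceded by
  exactly \<open>j\<close> zeros.\<close>

definition entry :: "bool list \<Rightarrow> nat \<Rightarrow> nat" where
  "entry x j = (\<Sum>p<Suc (length x). of_bool (input_at x p = 1 \<and> zeros x p = j))"

text \<open>\<open>Bind\<close> evaluates the argument outside the sum, so the argument may mention
  any variable and nested uses may share variable numbers.\<close>

definition Zeros :: "expr \<Rightarrow> expr" where
  "Zeros e = Bind 1 e (Sum_below 2 (And (Less (Var 2) (Var 1)) (Equal (Bit (Var 2)) (Cst 0))))"

definition Entry :: "expr \<Rightarrow> expr" where
  "Entry e = Bind 1 e (Sum_below 2 (And (Equal (Bit (Var 2)) (Cst 1)) (Equal (Zeros (Var 2)) (Var 1))))"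

lemma eval_Zeros [simp]: "eval x \<rho> (Zeros e) = zeros x (eval x \<rho> e)"
  by (simp add: Zeros_def eval_Sum_below zeros_def del: sum.lessThan_Suc)

lemma eval_Entry [simp]: "eval x \<rho> (Entry e) = entry x (eval x \<rho> e)"
  by (simp add: Entry_def eval_Sum_below entry_def del: sum.lessThan_Suc)

lemma input_at_Cons [simp]: "input_at (b # x) 0 = of_bool b" "input_at (b # x) (Suc i) = input_at x i"
  by (simp_all add: input_at_def)

lemma zeros_0 [simp]: "zeros x 0 = 0"
  by (simp add: zeros_def)

lemma zeros_Nil [simp]: "zeros [] p = 0"
  by (simp add: zeros_def input_at_def)

lemma zeros_Cons [simp]: "zeros (b # x) (Suc p) = of_bool (\<not> b) + zeros x p"
  unfolding zeros_def by (subst sum.lessThan_Suc_shift) (simp add: of_bool_def del: sum.lessThan_Suc)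

lemma entry_Nil [simp]: "entry [] j = 0"
  by (simp add: entry_def input_at_def)

lemma entry_Cons_True [simp]: "entry (True # x) j = of_bool (j = 0) + entry x j"
  unfolding entry_def by (subst sum.lessThan_Suc_shift) (simp del: sum.lessThan_Suc)

lemma entry_Cons_False [simp]:
  "entry (False # x) 0 = 0" "entry (False # x) (Suc j) = entry x j"
  unfolding entry_def by (subst sum.lessThan_Suc_shift, simp del: sum.lessThan_Suc)+

lemma unary_0 [simp]: "unary 0 = [False]" and unary_Suc [simp]: "unary (Suc n) = True # unary n"
  by (simp_all add: unary_def)

lemma entry_unary:
  "entry (unary n @ x) 0 = n" "entry (unary n @ x) (Suc j) = entry x j"
  by (induction n) simp_all

lemma entry_concat_unary:
  "entry (concat (map unary ys)) j = (if j < length ys then ys ! j else 0)"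
  by (induction ys arbitrary: j) (auto simp: entry_unary nth_Cons split: nat.splits)

text \<open>Each unary number contributes exactly its terminating zero.\<close>

lemma zeros_concat_unary:
  "zeros (concat (map unary ys)) (length (concat (map unary ys))) = length ys"
proof (induction ys)
  case (Cons y ys)
  have "zeros (unary n @ x) (length (unary n @ x)) = Suc (zeros x (length x))" for n x
    by (induction n) simp_all
  then show ?case using Cons.IH by simp
qed simp

text \<open>Built from the right: a leading one increments the first number, a leading zero prepends
  the number 0.\<close>

lemma obtain_unary:
  assumes "x \<noteq> []" "\<not> last x"
  obtains ys where "x = concat (map unary ys)"
proof -
  have "\<exists>ys. x = concat (map unary ys)"
    using assms
  proof (induction x)
    case (Cons b x)
    show ?case
    proof (cases "x = []")
      case True
      then show ?thesis using Cons.prems by (intro exI[of _ "[0]"]) simp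
    next
      case False
      then obtain ys where ys: "x = concat (map unary ys)" using Cons by auto
      with False obtain y ys' where "ys = y # ys'" by (cases ys) auto
      with ys have "b # x = concat (map unary (if b then Suc y # ys' else 0 # ys))" by simp
      then show ?thesis by blast
    qed
  qed simp
  then show ?thesis using that by blast
qed

text \<open>Expressions have no product, but \<open>k\<close> will be the fixed alphabet size, so
  repeated addition suffices; \<open>Disj\<close> serves as the iterated sum.\<close>

definition Times :: "nat \<Rightarrow> expr \<Rightarrow> expr" where
  "Times k e = Bind 1 e (Disj (replicate k (Var 1)))"

lemma eval_Times [simp]: "eval x \<rho> (Times k e) = k * eval x \<rho> e"
proof -
  have "eval x \<rho> (foldr Plus (replicate k (Var v)) (Cst 0)) = k * \<rho> v" for \<rho> v
    by (induction k) auto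
  then show ?thesis by (simp add: Times_def Disj_def)
qed

text \<open>Entry 0 of the input is the number of states, and state \<open>q\<close> goes to entry \<open>1 + k * q + i\<close>
  under the \<open>i\<close>-th of the \<open>k\<close> letters.\<close>

definition delta :: "nat \<Rightarrow> bool list \<Rightarrow> nat \<Rightarrow> nat list \<Rightarrow> nat" where
  "delta k x = foldl (\<lambda>q i. entry x (Suc (k * q + i)))"

definition Delta :: "nat \<Rightarrow> expr \<Rightarrow> nat list \<Rightarrow> expr" where
  "Delta k = foldl (\<lambda>e i. Entry (Plus (Plus (Cst 1) (Times k e)) (Cst i)))"

lemma eval_Delta [simp]: "eval x \<rho> (Delta k e w) = delta k x (eval x \<rho> e) w"
  unfolding Delta_def delta_def by (induction w arbitrary: e) auto

text \<open>The iteration count \<open>Suc (length x)\<close> becomes the pumping exponent; variable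
  1 carries the current state.\<close>

definition Pump :: "nat \<Rightarrow> expr \<Rightarrow> nat list \<Rightarrow> nat list \<Rightarrow> expr" where
  "Pump k e u v = Rec 1 2 (Delta k e u) (Delta k (Var 1) v)"

lemma eval_Pump [simp]:
  "eval x \<rho> (Pump k e u v) = delta k x (eval x \<rho> e) (pump u v (Suc (length x)))"
proof -
  have "rec_nat (delta k x q u) (\<lambda>j z. delta k x z v) n = delta k x q (pump u v n)" for n q
  proof (induction n)
    case (Suc n)
    \<comment> \<open>The loop applies the newest copy of \<open>v\<close> last, so it is split off
      at the right end.\<close>
    have "concat (replicate (Suc n) v) = concat (replicate n v) @ v"
      by (simp add: replicate_append_same[symmetric] del: replicate_Suc add: replicate_Suc)
    then show ?case using Suc by (simp add: pump_def delta_def del: replicate_Suc)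
  qed (simp add: pump_def delta_def)
  then show ?thesis by (simp add: Pump_def del: old.nat.rec)
qed

definition States :: expr where
  "States = Entry (Cst 0)"

text \<open>A final zero makes the input a sequence of unary numbers, the zeros count them, and the
  last test bounds the table entries. Even a missing entry reads as 0 and must be below the number
  of states, which is thus positive. \<open>Len\<close> exceeds the length by one, so 2 is
  subtracted to reach the last position.\<close>

definition Well_formed :: "nat \<Rightarrow> expr" where
  "Well_formed k = Conj
     [Equal (Bit (Minus Len (Cst 2))) (Cst 0),
      Equal (Zeros Len) (Plus (Cst 1) (Times k States)),
      Forall 1 (Less (Entry (Plus (Var 1) (Cst 1))) States)]"

definition Commutative :: "nat \<Rightarrow> expr" where
  "Commutative k = Forall 1 (Imp (Less (Var 1) States)
     (Conj [Equal (Delta k (Var 1) [i, j]) (Delta k (Var 1) [j, i]). i \<leftarrow> [0..<k], j \<leftarrow> [0..<k]]))"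

text \<open>The image is a singleton iff every state ends where state 0 does; state 0 exists in
  every well-formed input.\<close>

definition Synchronizing :: "nat \<Rightarrow> nat list \<times> nat list \<Rightarrow> expr" where
  "Synchronizing k = (\<lambda>(u, v). Forall 1 (Imp (Less (Var 1) States)
     (Equal (Pump k (Var 1) u v) (Pump k (Cst 0) u v))))"

lemma eval_States [simp]: "eval x \<rho> States = entry x 0"
  by (simp add: States_def)

lemma eval_Well_formed:
  "eval x \<rho> (Well_formed k) = of_bool (x \<noteq> [] \<and> \<not> last x \<and>
     zeros x (length x) = 1 + k * entry x 0 \<and> (\<forall>j\<le>length x. entry x (Suc j) < entry x 0))"
proof -
  \<comment> \<open>\<open>Len\<close> covers one position too many, but the end marker there is not
    a zero.\<close>
  have "zeros x (Suc (length x)) = zeros x (length x)"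
    unfolding zeros_def by (intro sum.cong) (auto simp: input_at_def)
  moreover have "input_at x (length x - 1) = 0 \<longleftrightarrow> x \<noteq> [] \<and> \<not> last x"
    by (cases "x = []") (auto simp: input_at_def last_conv_nth)
  ultimately show ?thesis by (auto simp: Well_formed_def eval_Forall numeral_2_eq_2)
qed

lemma eval_Commutative:
  "eval x \<rho> (Commutative k) = of_bool (\<forall>q\<le>length x. q < entry x 0 \<longrightarrow>
     (\<forall>i\<in>{0..<k}. \<forall>j\<in>{0..<k}. delta k x q [i, j] = delta k x q [j, i]))"
  by (auto simp: Commutative_def eval_Forall)

lemma eval_Synchronizing:
  "eval x \<rho> (Synchronizing k (u, v)) = of_bool (\<forall>q\<le>length x. q < entry x 0 \<longrightarrow>
     delta k x q (pump u v (Suc (length x))) = delta k x 0 (pump u v (Suc (length x))))"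
  by (auto simp: Synchronizing_def eval_Forall)


section \<open>Codes of automata\<close>

lemma length_concat_rows:
  "(\<And>q. length (f q) = k) \<Longrightarrow> length (concat (map f [0..<n])) = k * n"
  by (induction n) auto

lemma nth_concat_rows:
  assumes "\<And>q. length (f q) = k" "j < k * n"
  shows "concat (map f [0..<n]) ! j = f (j div k) ! (j mod k)"
  using assms(2)
proof (induction n)
  case (Suc n)
  note len = length_concat_rows[of f k n, OF assms(1)]
  show ?case
  proof (cases "j < k * n")
    case True
    then show ?thesis using Suc.IH len by (simp add: nth_append)
  next
    case False
    then obtain r where r: "j = k * n + r" by (metis le_iff_add not_less)
    then have "r < k" using Suc.prems by simp
    then show ?thesis using len r by (simp add: nth_append)
  qed
qed simp

lemma concat_unary_last: "ys \<noteq> [] \<Longrightarrow> concat (map unary ys) \<noteq> [] \<and> \<not> last (concat (map unary ys))"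
  by (induction ys rule: rev_induct) (auto simp: unary_def)

definition input_automaton :: "'a list \<Rightarrow> (nat, 'a) semi_automaton \<Rightarrow> bool" where
  "input_automaton as A \<longleftrightarrow>
     is_semi_automaton A \<and> alphabet A = set as \<and> states A = {0..<card (states A)}"

lemma input_automatonD:
  assumes "input_automaton as A"
  shows "is_semi_automaton A" "alphabet A = set as" "states A = {0..<card (states A)}"
    and "q \<in> states A \<longleftrightarrow> q < card (states A)"
    and "q < card (states A) \<Longrightarrow> a \<in> set as \<Longrightarrow> trans A q a < card (states A)"
proof -
  note assms[unfolded input_automaton_def]
  then show semi: "is_semi_automaton A" and al: "alphabet A = set as"
    and st: "states A = {0..<card (states A)}"
    by blast+
  have st_iff: "p \<in> states A \<longleftrightarrow> p < card (states A)" for p by (subst st) simp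
  then show "q \<in> states A \<longleftrightarrow> q < card (states A)" .
  show "trans A q a < card (states A)" if "q < card (states A)" "a \<in> set as"
    using semi that unfolding is_semi_automaton_def by (simp add: al flip: st_iff)
qed

definition table :: "'a list \<Rightarrow> (nat, 'a) semi_automaton \<Rightarrow> nat list" where
  "table as A = concat (map (\<lambda>q. map (trans A q) as) [0..<card (states A)])"

lemma encode_table: "encode as A = concat (map unary (card (states A) # table as A))"
  by (simp add: encode_def table_def Let_def map_concat comp_def)

lemma length_table: "length (table as A) = length as * card (states A)"
  unfolding table_def by (rule length_concat_rows) simp

lemma nth_table:
  assumes "j < length as * card (states A)"
  shows "table as A ! j = trans A (j div length as) (as ! (j mod length as))"
proof -
  have "0 < length as" using assms by (cases as) auto
  then show ?thesis unfolding table_def by (subst nth_concat_rows[OF _ assms]) auto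
qed

lemma entry_encode:
  "entry (encode as A) 0 = card (states A)"
  "entry (encode as A) (Suc j) = (if j < length (table as A) then table as A ! j else 0)"
  unfolding encode_table entry_concat_unary by simp_all

lemma entry_encode_trans:
  assumes "q < card (states A)" "i < length as"
  shows "entry (encode as A) (Suc (length as * q + i)) = trans A q (as ! i)"
proof -
  have "length as * q + i < length as * Suc q" using assms(2) by simp
  also have "\<dots> \<le> length as * card (states A)" using assms(1) by (intro mult_le_mono2) simp
  finally have "length as * q + i < length as * card (states A)" .
  moreover have "as \<noteq> []" using assms(2) by auto
  then have "(length as * q + i) div length as = q" using assms(2) by simp
  ultimately show ?thesis using assms(2) by (simp add: entry_encode length_table nth_table)
qed

lemma delta_encode:
  assumes "input_automaton as A" "q < card (states A)" "w \<in> lists {..<length as}"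
  shows "delta (length as) (encode as A) q w = trans_word A q (map ((!) as) w)"
  using assms(2,3)
proof (induction w arbitrary: q)
  case (Cons i w)
  note D = input_automatonD[OF assms(1)]
  have "trans A q (as ! i) < card (states A)"
    using Cons.prems by (intro D(5)) auto
  then show ?case
    using Cons by (simp add: delta_def trans_word_def entry_encode_trans)
qed (simp add: delta_def trans_word_def)

definition index :: "'a list \<Rightarrow> 'a \<Rightarrow> nat" where
  "index as = inv_into {..<length as} ((!) as)"

lemma index: "a \<in> set as \<Longrightarrow> index as a < length as" "a \<in> set as \<Longrightarrow> as ! index as a = a"
proof -
  assume "a \<in> set as"
  then have "a \<in> (!) as ` {..<length as}" by (auto simp: in_set_conv_nth)
  then show "index as a < length as" "as ! index as a = a"
    using inv_into_into[of a "(!) as" "{..<length as}"] f_inv_into_f[of a "(!) as" "{..<length as}"]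
    by (simp_all add: index_def)
qed

lemma index_nth: "distinct as \<Longrightarrow> i < length as \<Longrightarrow> index as (as ! i) = i"
  by (simp add: index_def inj_on_nth inv_into_f_f)

lemma eval_Well_formed_iff:
  assumes "distinct as"
  shows "eval x \<rho> (Well_formed (length as)) =
    of_bool (\<exists>A. input_automaton as A \<and> 0 < card (states A) \<and> x = encode as A)"
proof -
  let ?k = "length as"
  let ?wf = "x \<noteq> [] \<and> \<not> last x \<and> zeros x (length x) = 1 + ?k * entry x 0 \<and>
     (\<forall>j\<le>length x. entry x (Suc j) < entry x 0)"
  have "\<exists>A. input_automaton as A \<and> 0 < card (states A) \<and> x = encode as A" if wf: ?wf
  proof -
    obtain ys where ys: "x = concat (map unary ys)" using wf obtain_unary by blast
    define n where "n = entry x 0"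
    have len: "length ys = 1 + ?k * n"
      using wf zeros_concat_unary[of ys] by (simp add: ys n_def)
    have entry: "entry x j = (if j < length ys then ys ! j else 0)" for j
      by (simp add: ys entry_concat_unary)
    \<comment> \<open>Every unary number has at least one bit, so entries with index beyond
      \<open>length x\<close> are missing and read as 0; the bounded test therefore covers all
      \<open>j\<close>.\<close>
    have "length ys \<le> length x"
      unfolding ys by (induction ys) (auto simp: unary_def)
    moreover have n: "0 < n" using wf by (auto simp: n_def)
    ultimately have less: "entry x (Suc j) < n" for j
      using wf entry[of "Suc j"] by (cases "j \<le> length x") (auto simp: n_def)
    \<comment> \<open>The automaton is read back from the input by inverting the row-by-row layout
      of the table.\<close>
    define A where "A = \<lparr>alphabet = set as, states = {0..<n},
      trans = \<lambda>q a. entry x (Suc (?k * q + index as a))\<rparr>"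
    have A: "input_automaton as A" "card (states A) = n"
      using less by (auto simp: A_def input_automaton_def is_semi_automaton_def)
    have "ys = n # table as A"
    proof (rule nth_equalityI)
      show "length ys = length (n # table as A)" by (simp add: len length_table A)
      fix j assume j: "j < length ys"
      show "ys ! j = (n # table as A) ! j"
      proof (cases j)
        case 0
        then show ?thesis using j entry[of 0] by (simp add: n_def)
      next
        case (Suc i)
        then have i: "i < ?k * n" using j len by simp
        then have "0 < ?k" by (cases as) auto
        then have "table as A ! i = entry x (Suc i)"
          using i assms by (subst nth_table) (auto simp: A(2) A_def index_nth)
        then show ?thesis using Suc j entry[of j] by simp
      qed
    qed
    then have "x = encode as A" by (simp add: ys encode_table A)
    then show ?thesis using A n by blast
  qed
  then show ?thesis unfolding eval_Well_formed
  proof (intro arg_cong[of _ _ of_bool] iffI)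
    assume "\<exists>A. input_automaton as A \<and> 0 < card (states A) \<and> x = encode as A"
    then obtain A where A: "input_automaton as A" "0 < card (states A)" "x = encode as A"
      by blast
    have "table as A ! j < card (states A)" if "j < length (table as A)" for j
    proof -
      have j: "j < ?k * card (states A)" using that by (simp add: length_table)
      then have "0 < ?k" by (cases as) auto
      note D = input_automatonD[OF A(1)]
      have "j div ?k < card (states A)" "as ! (j mod ?k) \<in> set as"
        using j \<open>0 < ?k\<close> by (simp_all add: less_mult_imp_div_less mult.commute)
      then show ?thesis
        using D(5) j by (simp add: nth_table)
    qed
    then have "entry x (Suc j) < entry x 0" for j
      using A(2,3) by (simp add: entry_encode)
    moreover have "zeros x (length x) = 1 + ?k * entry x 0"
      using zeros_concat_unary[of "card (states A) # table as A"]
      by (simp only: A(3) encode_table[symmetric]) (simp add: entry_encode length_table)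
    moreover have "x \<noteq> []" "\<not> last x"
      using concat_unary_last[of "card (states A) # table as A"]
      by (simp_all only: A(3) encode_table) simp_all
    ultimately show ?wf by blast
  qed
qed

section \<open>Correctness of the tests on codes\<close>

context
  fixes as :: "'a list" and A and x
  assumes A: "input_automaton as A" "0 < card (states A)" and x: "x = encode as A"
begin

lemmas A_facts = input_automatonD[OF A(1)]

lemma card_states_le: "card (states A) \<le> length x"
  by (simp add: x encode_table unary_def)

text \<open>The number of states is written in unary and so is at most the input length; the bounded
  quantifiers reach every state.\<close>

lemma all_states_iff:
  "(\<forall>q\<le>length x. q < entry x 0 \<longrightarrow> P q) \<longleftrightarrow> (\<forall>q<card (states A). P q)"
  using card_states_le unfolding x entry_encode by (meson less_imp_le_nat order_less_le_trans)

lemma eval_Commutative_iff: "eval x \<rho> (Commutative (length as)) = of_bool (commutative A)"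
proof -
  have "commutative A \<longleftrightarrow> (\<forall>q<card (states A). \<forall>i<length as. \<forall>j<length as.
      trans_word A q [as ! i, as ! j] = trans_word A q [as ! j, as ! i])"
    unfolding commutative_def A_facts(2) by (simp add: Ball_def[of "states A"] A_facts(4) all_set_conv_all_nth)
  also have "\<dots> \<longleftrightarrow> (\<forall>q<card (states A). \<forall>i<length as. \<forall>j<length as.
      delta (length as) x q [i, j] = delta (length as) x q [j, i])"
    using A(1) by (simp add: x delta_encode)
  finally show ?thesis by (simp add: eval_Commutative all_states_iff Ball_def)
qed

lemma eval_Synchronizing_iff:
  assumes "u \<in> lists (set as)" "v \<in> lists (set as)"
  shows "eval x \<rho> (Synchronizing (length as) (map (index as) u, map (index as) v)) =
    of_bool (synchronizing A (pump u v (Suc (length x))))"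
proof -
  let ?w = "pump u v (Suc (length x))"
  let ?i = "pump (map (index as) u) (map (index as) v) (Suc (length x))"
  have map: "map ((!) as) (map (index as) w) = w" if "w \<in> lists (set as)" for w
    using that by (induction w) (auto simp: index)
  have i_eq: "?i = map (index as) ?w"
    by (simp add: pump_def map_concat)
  have w: "?w \<in> lists (set as)" using assms by (rule pump_in_lists)
  have "index as a < length as" if "a \<in> set ?w" for a
    using w that by (intro index(1)) auto
  then have i: "?i \<in> lists {..<length as}"
    unfolding i_eq by auto
  have delta: "delta (length as) x q ?i = trans_word A q ?w" if "q < card (states A)" for q
    using delta_encode[OF A(1) that i, folded x] by (simp only: i_eq map[OF w])
  have "synchronizing A ?w \<longleftrightarrow> card ((\<lambda>q. trans_word A q ?w) ` {0..<card (states A)}) = 1"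
    unfolding synchronizing_def trans_set_def A_facts(2) by (subst (1) A_facts(3)) (use w in simp)
  also have "\<dots> \<longleftrightarrow> (\<forall>q<card (states A). trans_word A q ?w = trans_word A 0 ?w)"
  proof
    assume "card ((\<lambda>q. trans_word A q ?w) ` {0..<card (states A)}) = 1"
    then obtain p where p: "(\<lambda>q. trans_word A q ?w) ` {0..<card (states A)} = {p}"
      using card_1_singletonE by blast
    have "trans_word A q ?w = p" if "q < card (states A)" for q
      using imageI[of q "{0..<card (states A)}" "\<lambda>q. trans_word A q ?w"] that unfolding p by simp
    then show "\<forall>q<card (states A). trans_word A q ?w = trans_word A 0 ?w" using A(2) by simp
  next
    assume "\<forall>q<card (states A). trans_word A q ?w = trans_word A 0 ?w"
    then have "(\<lambda>q. trans_word A q ?w) ` {0..<card (states A)} =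
        (\<lambda>_. trans_word A 0 ?w) ` {0..<card (states A)}"
      by (intro image_cong refl) (meson atLeastLessThan_iff)
    then have "(\<lambda>q. trans_word A q ?w) ` {0..<card (states A)} = {trans_word A 0 ?w}"
      using A(2) by (simp add: image_constant_conv)
    then show "card ((\<lambda>q. trans_word A q ?w) ` {0..<card (states A)}) = 1" by simp
  qed
  also have "\<dots> \<longleftrightarrow> (\<forall>q<card (states A). delta (length as) x q ?i = delta (length as) x 0 ?i)"
    using A(2) by (simp add: delta)
  finally show ?thesis by (simp only: eval_Synchronizing all_states_iff)
qed

end

theorem theorem3p10:
  fixes \<Sigma> :: "'a set" and L :: "'a list set" and as :: "'a list"
  assumes "finite \<Sigma>"
    and "distinct as" and "set as = \<Sigma>"
    and "L \<subseteq> lists \<Sigma>" and "regular \<Sigma> L"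
  shows "polynomial_time (commutative_constrained_sync as L)"
proof -
  obtain J where J: "set J \<subseteq> lists \<Sigma> \<times> lists \<Sigma>"
    "\<forall>(A :: (nat, 'a) semi_automaton) n. is_semi_automaton A \<longrightarrow> commutative A \<longrightarrow> alphabet A = \<Sigma> \<longrightarrow>
      card (states A) \<le> n \<longrightarrow>
      ((\<exists>w\<in>L. synchronizing A w) \<longleftrightarrow> (\<exists>(u, v)\<in>set J. synchronizing A (pump u v n)))"
    using finite_pumps[OF assms(1,4)] by blast
  \<comment> \<open>\<open>J\<close> is fixed along with the language, so \<open>e\<close> is a
    single expression for all inputs.\<close>
  define e where "e = Conj [Well_formed (length as), Commutative (length as),
    Disj (map (\<lambda>(u, v). Synchronizing (length as) (map (index as) u, map (index as) v)) J)]"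
  have "eval x (\<lambda>_. 0) e = of_bool (x \<in> commutative_constrained_sync as L)" for x
  proof -
    let ?A = "\<lambda>A. input_automaton as A \<and> 0 < card (states A) \<and> x = encode as A"
    have "(0 < eval x (\<lambda>_. 0) (Commutative (length as)) \<and> (\<exists>(u, v)\<in>set J.
          0 < eval x (\<lambda>_. 0) (Synchronizing (length as) (map (index as) u, map (index as) v)))) \<longleftrightarrow>
        commutative A \<and> (\<exists>w\<in>L. synchronizing A w)" if A: "?A A" for A
    proof -
      have "0 < eval x (\<lambda>_. 0) (Synchronizing (length as) (map (index as) u, map (index as) v)) \<longleftrightarrow>
          synchronizing A (pump u v (Suc (length x)))" if "(u, v) \<in> set J" for u v
        using eval_Synchronizing_iff[of as A x u v "\<lambda>_. 0"] J(1) assms(3) A that by force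
      then have "(\<exists>(u, v)\<in>set J.
          0 < eval x (\<lambda>_. 0) (Synchronizing (length as) (map (index as) u, map (index as) v))) \<longleftrightarrow>
          (\<exists>(u, v)\<in>set J. synchronizing A (pump u v (Suc (length x))))"
        by (intro bex_cong refl) (simp add: split_def)
      moreover have "0 < eval x (\<lambda>_. 0) (Commutative (length as)) \<longleftrightarrow> commutative A"
        using eval_Commutative_iff[of as A x "\<lambda>_. 0"] A by simp
      \<comment> \<open>This qualifies the iteration count as a pumping exponent for
        \<open>J\<close>.\<close>
      moreover have "card (states A) \<le> Suc (length x)"
        using A card_states_le le_SucI by blast
      then have "commutative A \<Longrightarrow> (\<exists>w\<in>L. synchronizing A w) \<longleftrightarrow>
          (\<exists>(u, v)\<in>set J. synchronizing A (pump u v (Suc (length x))))"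
        using J(2)[rule_format, of A "Suc (length x)"] A assms(3) input_automatonD(1,2)[of as A]
        by blast
      ultimately show ?thesis by (simp only: cong: conj_cong)
    qed
    then have "0 < eval x (\<lambda>_. 0) e \<longleftrightarrow>
        (\<exists>A. ?A A \<and> commutative A \<and> (\<exists>w\<in>L. synchronizing A w))"
      unfolding e_def using assms(2) by (simp add: eval_Well_formed_iff split_def) blast
    also have "\<dots> \<longleftrightarrow> (\<exists>A. input_automaton as A \<and> x = encode as A \<and> commutative A \<and>
        (\<exists>w\<in>L. synchronizing A w))"
    proof -
      \<comment> \<open>An image of cardinality 1 presupposes a state, so the positivity enforced by
        \<open>Well_formed\<close> excludes no yes-instance.\<close>
      have "0 < card (states A)" if "input_automaton as A" "synchronizing A w" for A w
      proof -
        have "finite (states A)"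
          using input_automatonD(1)[OF that(1)] by (simp add: is_semi_automaton_def)
        then show ?thesis using that(2) by (auto simp: synchronizing_def trans_set_def card_gt_0_iff)
      qed
      then have "?A A \<and> commutative A \<and> (\<exists>w\<in>L. synchronizing A w) \<longleftrightarrow>
          input_automaton as A \<and> x = encode as A \<and> commutative A \<and> (\<exists>w\<in>L. synchronizing A w)" for A
        by blast
      then show ?thesis by (rule ex_cong1)
    qed
    also have "\<dots> \<longleftrightarrow> x \<in> commutative_constrained_sync as L"
      unfolding commutative_constrained_sync_def input_automaton_def by blast
    finally show ?thesis by (simp add: e_def)
  qed
  then show ?thesis by (rule polynomial_timeI)
qed

end
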